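(* Let $k\ge 1$ be an integer and let $\lambda$ be a $k$-bounded partition with $k\ge h_M(\lambda)$, where $h_M(\lambda)=\lambda_1+\ell(\lambda)-1$. Then $$A_\lambda^{(k)}[X;t]=S_\lambda[X].$$
   Context: Tableaux. Diagrams of partitions are drawn with row $i$ (counted from the bottom) of length $\lambda_i$. $\ell(\lambda)$ is the number of nonzero parts, and $\lambda$ is $k$-bounded if $\lambda_1\le k$. A tableau is a filling of a partition diagram by positive integers, nondecreasing along rows (left to right) and strictly increasing up columns. It is identified with its reading word, obtained by reading rows left to right, from the top row to the bottom row. The evaluation of a word is $(\rho_1,\rho_2,\dots)$, $\rho_i$ being the number of letters $i$. $\equiv$ denotes Knuth (plactic) equivalence: $acb\equiv cab$ for $a\le b<c$ and $bac\equiv bca$ for $a<b\le c$. Every word is Knuth equivalent to a unique tableau. $\mathbb H_0$ is the empty tableau. Sets of tableaux are identified with formal sums of their elements, and operators are extended linearly. Symmetric group action. $\sigma_i$ acts on a word through its subword in the letters $i,i+1$: successively pair every factor $(i+1)\,i$ (ignoring already paired letters) until the unpaired letters form $i^r(i+1)^s$; replace these by $i^s(i+1)^r$. This gives an action of the symmetric group on words, sending tableaux to tableaux of the same shape. Promotion. For $T$ of evaluation $(\lambda_1,\dots,\lambda_m)$, $\mathbb B_r(T)=\sigma_1\cdots\sigma_m\,\mathbb R_r T$, where $\mathbb R_rT$ is the sum of all tableaux obtained by adding to $T$ a horizontal $r$-strip of letters $m+1$. Filtering. The main hook-length is $h_M(\lambda)=\lambda_1+\ell(\lambda)-1$. The $k$-split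 of a $k$-bounded $\lambda$ is the sequence $\lambda^{\to k}=(\lambda^{(1)},\dots,\lambda^{(r)})$ obtained by cutting $\lambda$ (keeping the order of its parts) into consecutive partitions with $h_M(\lambda^{(i)})=k$ for all $i\ne r$ (the last one may have main hook-length less than $k$). For a tableau $T$ whose shape contains $\lambda$, let $T_\lambda$ be its subtableau of shape $\lambda$, $T_1$ the part of $T$ outside $T_\lambda$ in the first $\ell(\lambda)$ rows, $T_2$ the part of $T$ above those rows, and $\overline T$ the unique tableau Knuth equivalent to the word $T_1T_2$ (reading word of $T_1$ followed by that of $T_2$). $S(\lambda)$ is the set of tableaux of shape $\lambda$ and evaluation $(0^m,\lambda_1,\lambda_2,\dots)$, $m\in\mathbb N$. The restricted $\lambda$-katabolism is $\overline{\mathbb K}_\lambda(T)=\overline T$ if $\lambda\subseteq\mathrm{shape}(T)$ and $T_\lambda\in S(\lambda)$, and $0$ otherwise. For $S=(\lambda^{(1)},\dots,\lambda^{(r)})$, $\mathbb P_S(T)=T$ if $\overline{\mathbb K}_{\lambda^{(r)}}\cdots\overline{\mathbb K}_{\lambda^{(1)}}(T)=\mathbb H_0$, and $0$ otherwise. Super atoms. $\mathbb A^{(k)}_0=\mathbb H_0$ and, for a $k$-bounded partition $\lambda$, $\mathbb A_\lambda^{(k)}=\mathbb P_{\lambda^{\to k}}\,\mathbb B_{\lambda_1}\big(\mathbb A^{(k)}_{(\lambda_2,\lambda_3,\dots)}\big)$. Charge. For a word $w$ whose evaluation is a partition: read $w$ from right to left, cyclically. Starting at the right end with label $\ell=0$,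 label with $\ell$ the first $1$ met, then the first $2$ met after it, then the first $3$ after that, etc., increasing $\ell$ by $1$ each time one passes from the left end of $w$ back to its right end. When the letters are exhausted repeat on the unlabeled letters, again from the right end with $\ell=0$, until all letters are labeled. $\mathrm{charge}(w)$ is the sum of the labels. If the evaluation is not a partition, first apply a permutation $\sigma$ (via the $\sigma_i$) making it one and set $\mathrm{charge}(w)=\mathrm{charge}(\sigma w)$. Atoms. $S_\lambda[X]$ is the Schur function in $X=x_1+x_2+\cdots$. $\digamma$ is the linear map $\digamma(T)=t^{\mathrm{charge}(T)}S_{\mathrm{shape}(T)}[X]$, and $A_\lambda^{(k)}[X;t]=\digamma(\mathbb A_\lambda^{(k)})$. *)

theory Defs
  imports "HOL-Library.More_List" "HOL-Library.Poly_Mapping"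
    "HOL-Computational_Algebra.Polynomial"
begin

section \<open>Partitions and tableaux\<close>

text \<open>
  A partition is the list of its nonzero parts, so that its length is the number of nonzero parts.
  The empty list is the zero partition.
\<close>

definition is_partition :: "nat list \<Rightarrow> bool" where
  "is_partition lam \<longleftrightarrow> sorted_wrt (\<ge>) lam \<and> 0 \<notin> set lam"

definition part :: "nat list \<Rightarrow> nat \<Rightarrow> nat" where
  "part lam i = nth_default 0 lam (i - 1)"

definition k_bounded :: "nat \<Rightarrow> nat list \<Rightarrow> bool" where
  "k_bounded k lam \<longleftrightarrow> part lam 1 \<le> k"

text \<open>Integer valued, because it is \<open>- 1\<close> for the zero partition.\<close>

definition main_hook :: "nat list \<Rightarrow> int" where
  "main_hook lam = int (part lam 1) + int (length lam) - 1"

text \<open>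
  A filling is the list of its rows, bottom row first; it has no empty rows when it is a tableau.
  The reading word starts with the top row, that is, with the last list.
\<close>

type_synonym filling = "nat list list"

definition shape :: "filling \<Rightarrow> nat list" where
  "shape T = map length T"

definition word :: "filling \<Rightarrow> nat list" where
  "word T = concat (rev T)"

definition is_tableau :: "filling \<Rightarrow> bool" where
  "is_tableau T \<longleftrightarrow>
     is_partition (shape T) \<and> 0 \<notin> set (word T) \<and> (\<forall>R \<in> set T. sorted R) \<and>
     (\<forall>i j. Suc i < length T \<and> j < length (T ! Suc i) \<longrightarrow> T ! i ! j < T ! Suc i ! j)"

text \<open>Letters are positive; the number \<open>\<rho>\<^sub>i\<close> of letters \<open>i\<close> in \<open>w\<close> is \<open>count_list w i\<close>.\<close>

definition max_letter :: "nat list \<Rightarrow> nat" where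
  "max_letter w = Max (insert 0 (set w))"

inductive knuth_step :: "nat list \<Rightarrow> nat list \<Rightarrow> bool" where
  "a \<le> b \<Longrightarrow> b < c \<Longrightarrow> knuth_step (u @ [a, c, b] @ v) (u @ [c, a, b] @ v)"
| "a < b \<Longrightarrow> b \<le> c \<Longrightarrow> knuth_step (u @ [b, a, c] @ v) (u @ [b, c, a] @ v)"

definition knuth_equiv :: "nat list \<Rightarrow> nat list \<Rightarrow> bool" where
  "knuth_equiv = equivclp knuth_step"

definition tableau_of_word :: "nat list \<Rightarrow> filling" where
  "tableau_of_word w = (THE T. is_tableau T \<and> knuth_equiv (word T) w)"

section \<open>Formal sums of tableaux\<close>

text \<open>
  Formal sums are elements of the free abelian group on the fillings, with \<open>frag_of T\<close> the basis
  element of \<open>T\<close> and \<open>frag_extend\<close> the linear extension of an operator given on the basis.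
\<close>

type_synonym formal_sum = "filling \<Rightarrow>\<^sub>0 int"

definition sum_of_set :: "filling set \<Rightarrow> formal_sum" where
  "sum_of_set A = (\<Sum>T \<in> A. frag_of T)"

section \<open>Symmetric group action\<close>

text \<open>
  \<open>unpaired i [] xs\<close> cancels the factors \<open>(i+1) i\<close> in the list \<open>xs\<close> of (position, letter) pairs of
  the subword in the letters \<open>i, i+1\<close>. The first list argument is a stack of the uncancelled pairs
  read so far, last one on top; the result does not depend on the order of the cancellations.
\<close>

fun unpaired :: "nat \<Rightarrow> (nat \<times> nat) list \<Rightarrow> (nat \<times> nat) list \<Rightarrow> (nat \<times> nat) list" where
  "unpaired i st [] = rev st"
| "unpaired i st ((p, x) # xs) =
     (if st \<noteq> [] \<and> snd (hd st) = i + 1 \<and> x = i then unpaired i (tl st) xs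
      else unpaired i ((p, x) # st) xs)"

definition sigma_word :: "nat \<Rightarrow> nat list \<Rightarrow> nat list" where
  "sigma_word i w =
     (let us = unpaired i [] (filter (\<lambda>(p, x). x = i \<or> x = i + 1) (zip [0..<length w] w));
          r = length (filter (\<lambda>(p, x). x = i) us);
          s = length (filter (\<lambda>(p, x). x = i + 1) us)
      in fold (\<lambda>(p, y) v. v[p := y])
           (zip (map fst us) (replicate s i @ replicate r (i + 1))) w)"

fun cut :: "nat list \<Rightarrow> 'a list \<Rightarrow> 'a list list" where
  "cut [] w = []"
| "cut (n # ns) w = take n w # cut ns (drop n w)"

text \<open>\<open>refill mu w\<close> is the filling of shape \<open>mu\<close> with reading word \<open>w\<close>.\<close>

definition refill :: "nat list \<Rightarrow> nat list \<Rightarrow> filling" where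
  "refill mu w = rev (cut (rev mu) w)"

definition sigma :: "nat \<Rightarrow> filling \<Rightarrow> filling" where
  "sigma i T = refill (shape T) (sigma_word i (word T))"

section \<open>Promotion\<close>

definition contained :: "nat list \<Rightarrow> nat list \<Rightarrow> bool" where
  "contained mu nu \<longleftrightarrow> (\<forall>i \<ge> 1. part mu i \<le> part nu i)"

text \<open>\<open>nu/mu\<close> is a horizontal \<open>r\<close>-strip: \<open>r\<close> cells, no two of them in the same column.\<close>

definition horizontal_strip :: "nat \<Rightarrow> nat list \<Rightarrow> nat list \<Rightarrow> bool" where
  "horizontal_strip r nu mu \<longleftrightarrow>
     contained mu nu \<and> (\<forall>i \<ge> 1. part nu (i + 1) \<le> part mu i) \<and> sum_list nu = sum_list mu + r"

definition strip_additions :: "nat \<Rightarrow> nat \<Rightarrow> filling \<Rightarrow> filling set" where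
  "strip_additions r x T =
     {T'. is_tableau T' \<and> horizontal_strip r (shape T') (shape T) \<and>
          (\<forall>i < length T'. \<exists>n. T' ! i = nth_default [] T i @ replicate n x)}"

definition R_op :: "nat \<Rightarrow> filling \<Rightarrow> formal_sum" where
  "R_op r T = sum_of_set (strip_additions r (max_letter (word T) + 1) T)"

text \<open>The composite applies \<open>sigma m\<close> first and \<open>sigma 1\<close> last.\<close>

definition promotion :: "nat \<Rightarrow> formal_sum \<Rightarrow> formal_sum" where
  "promotion r = frag_extend (\<lambda>T.
     frag_extend (\<lambda>T'. frag_of (foldr sigma [1..<max_letter (word T) + 1] T')) (R_op r T))"

section \<open>Filtering\<close>

definition is_k_split :: "nat \<Rightarrow> nat list \<Rightarrow> nat list list \<Rightarrow> bool" where
  "is_k_split k lam S \<longleftrightarrow>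
     concat S = lam \<and> (\<forall>mu \<in> set S. is_partition mu \<and> mu \<noteq> []) \<and>
     (\<forall>mu \<in> set (butlast S). main_hook mu = int k) \<and>
     (S \<noteq> [] \<longrightarrow> main_hook (last S) \<le> int k)"

definition k_split :: "nat \<Rightarrow> nat list \<Rightarrow> nat list list" where
  "k_split k lam = (THE S. is_k_split k lam S)"

definition subtableau :: "nat list \<Rightarrow> filling \<Rightarrow> filling" where
  "subtableau lam T = map (\<lambda>(n, R). take n R) (zip lam T)"

text \<open>The words of \<open>T\<^sub>1\<close> (the skew part in the first \<open>length lam\<close> rows) and of \<open>T\<^sub>2\<close>.\<close>

definition word_right :: "nat list \<Rightarrow> filling \<Rightarrow> nat list" where
  "word_right lam T = word (map (\<lambda>(n, R). drop n R) (zip lam T))"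

definition word_above :: "nat list \<Rightarrow> filling \<Rightarrow> nat list" where
  "word_above lam T = word (drop (length lam) T)"

definition S_set :: "nat list \<Rightarrow> filling set" where
  "S_set lam = {T. is_tableau T \<and> shape T = lam \<and>
     (\<exists>m. \<forall>i \<ge> 1. count_list (word T) i = (if i \<le> m then 0 else part lam (i - m)))}"

definition katabolism :: "nat list \<Rightarrow> formal_sum \<Rightarrow> formal_sum" where
  "katabolism lam = frag_extend (\<lambda>T.
     if contained lam (shape T) \<and> subtableau lam T \<in> S_set lam
     then frag_of (tableau_of_word (word_right lam T @ word_above lam T)) else 0)"

text \<open>\<open>fold\<close> applies the katabolism of the first partition of \<open>S\<close> first.\<close>

definition P_op :: "nat list list \<Rightarrow> formal_sum \<Rightarrow> formal_sum" where
  "P_op S = frag_extend (\<lambda>T. if fold katabolism S (frag_of T) = frag_of [] then frag_of T else 0)"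

section \<open>Super atoms\<close>

primrec super_atom :: "nat \<Rightarrow> nat list \<Rightarrow> formal_sum" where
  "super_atom k [] = frag_of []"
| "super_atom k (a # lam) = P_op (k_split k (a # lam)) (promotion a (super_atom k lam))"

section \<open>Charge\<close>

definition partition_evaluation :: "nat list \<Rightarrow> bool" where
  "partition_evaluation w \<longleftrightarrow> (\<forall>i \<ge> 1. count_list w (i + 1) \<le> count_list w i)"

text \<open>
  State \<open>(U, p, l, c)\<close>: set of unlabeled positions of \<open>w\<close> (counted from the left), position of the
  letter labeled last, current label, and sum of the labels so far. Reading goes leftwards, so the
  next letter \<open>j\<close> met is the rightmost unlabeled one left of \<open>p\<close>; if there is none, one passes from
  the left end to the right end and it is the rightmost unlabeled \<open>j\<close>.
\<close>

type_synonym charge_state = "nat set \<times> nat \<times> nat \<times> nat"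

definition charge_step :: "nat list \<Rightarrow> nat \<Rightarrow> charge_state \<Rightarrow> charge_state" where
  "charge_step w j = (\<lambda>(U, p, l, c).
     let C = {q \<in> U. w ! q = j} in
     if C = {} then (U, p, l, c)
     else if \<exists>q \<in> C. q < p then
       (let q = Max {q \<in> C. q < p} in (U - {q}, q, l, c + l))
     else (let q = Max C in (U - {q}, q, l + 1, c + (l + 1))))"

text \<open>One round starts at the right end of \<open>w\<close> with label \<open>0\<close> and labels one letter \<open>1, 2, 3, \<dots>\<close>
  each, as long as there are any.\<close>

definition charge_round :: "nat list \<Rightarrow> nat set \<times> nat \<Rightarrow> nat set \<times> nat" where
  "charge_round w = (\<lambda>(U, c).
     case fold (charge_step w) [1..<max_letter w + 1] (U, length w, 0, c) of
       (U', p, l, c') \<Rightarrow> (U', c'))"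

text \<open>The evaluation is a partition here, so every round uses exactly one letter \<open>1\<close> and
  \<open>count_list w 1\<close> rounds label all letters.\<close>

definition charge_partition :: "nat list \<Rightarrow> nat" where
  "charge_partition w = snd ((charge_round w ^^ count_list w 1) ({..<length w}, 0))"

text \<open>If the evaluation is not a partition, the word in the orbit of \<open>w\<close> with partition
  evaluation is unique, since \<open>\<sigma>\<^sub>i\<close> fixes the words with equally many letters \<open>i\<close> and \<open>i+1\<close>.\<close>

definition charge :: "nat list \<Rightarrow> nat" where
  "charge w =
     (if partition_evaluation w then charge_partition w
      else charge_partition (SOME v. partition_evaluation v \<and>
             (\<exists>js. (\<forall>j \<in> set js. j \<ge> 1) \<and> v = foldr sigma_word js w)))"

section \<open>Schur functions and atoms\<close>

text \<open>
  A formal power series in \<open>x\<^sub>1, x\<^sub>2, \<dots>\<close> over the polynomials in \<open>t\<close> with integer coefficients,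
  given by its coefficients: the monomial \<open>\<alpha>\<close> has exponent \<open>lookup \<alpha> i\<close> at \<open>x\<^sub>i\<close>. As tableaux have
  positive letters, the series below do not involve the index \<open>0\<close>.
\<close>

type_synonym sym_series = "(nat \<Rightarrow>\<^sub>0 nat) \<Rightarrow> int poly"

text \<open>\<open>S\<^sub>\<lambda>[X] = \<Sum> x\<^sup>T\<close> over all tableaux \<open>T\<close> of shape \<open>\<lambda>\<close>.\<close>

definition schur :: "nat list \<Rightarrow> sym_series" where
  "schur lam = (\<lambda>\<alpha>. of_nat (card {T. is_tableau T \<and> shape T = lam \<and>
     (\<forall>i. count_list (word T) i = Poly_Mapping.lookup \<alpha> i)}))"

definition digamma_map :: "formal_sum \<Rightarrow> sym_series" where
  "digamma_map v = (\<lambda>\<alpha>. \<Sum>T \<in> Poly_Mapping.keys v.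
     of_int (Poly_Mapping.lookup v T) * monom 1 (charge (word T)) * schur (shape T) \<alpha>)"

definition atom_fn :: "nat \<Rightarrow> nat list \<Rightarrow> sym_series" where
  "atom_fn k lam = digamma_map (super_atom k lam)"

end

theory Submission
  imports Defs
begin

text \<open>
  When \<open>h\<^sub>M(\<lambda>) \<le> k\<close>, no proper beginning of \<open>\<lambda>\<close> has main hook-length \<open>k\<close>, so the \<open>k\<close>-split is the
  single block \<open>(\<lambda>)\<close>.  The super atom is then a single tableau, the superstandard one, whose \<open>i\<close>-th
  row consists of letters \<open>i\<close> only.  This is shown by induction on \<open>\<lambda> = (a, \<mu>)\<close>.

  Promotion turns the superstandard tableau of \<open>\<mu>\<close> into one tableau for each way of adding a
  horizontal \<open>a\<close>-strip, and the operators \<open>\<sigma>\<^sub>i\<close> do not change shapes.  All these tableaux have \<open>|\<lambda>|\<close>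
  cells, so that containing \<open>\<lambda>\<close> means having shape \<open>\<lambda>\<close>; the others are killed by the filter
  already because of their shape (\<open>P_op_other_shape\<close>).  There is exactly one strip giving shape
  \<open>\<lambda>\<close>, because \<open>\<lambda>/\<mu>\<close> is a horizontal strip (\<open>strip_additions_shape_iff\<close>).  What remains is to
  follow the corresponding tableau along \<open>\<sigma>\<^sub>m, \<dots>, \<sigma>\<^sub>1\<close>, where \<open>m = \<ell>(\<mu>)\<close>.  Each \<open>\<sigma>\<^sub>j\<close> just renames
  the strip letters \<open>j + 1\<close> in the rows up to \<open>j\<close> to \<open>j\<close>, since the letters \<open>j + 1\<close> of row \<open>j + 1\<close>
  are paired exactly with the letters \<open>j\<close> of row \<open>j\<close> (\<open>sigma_lowered\<close>).  The end of this chain is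
  the superstandard tableau of \<open>\<lambda>\<close>, which passes the filter.

  The reading word of the superstandard tableau is nonincreasing.  Reading it from the right, one
  never has to pass the end of the word within a round, so the charge is \<open>0\<close>
  (\<open>charge_partition_nonincreasing\<close>) and the atom is the Schur function itself.
\<close>

section \<open>Parts, words and shapes\<close>

lemma is_partition_Cons: "is_partition (a # lam) \<Longrightarrow> is_partition lam"
  by (simp add: is_partition_def)

lemma is_partition_nth_mono:
  assumes "is_partition lam" "i \<le> j" "j < length lam"
  shows "lam ! j \<le> lam ! i"
  using assms by (cases "i = j") (auto simp: is_partition_def sorted_wrt_iff_nth_less)

lemma part_Suc: "part lam (Suc i) = (if i < length lam then lam ! i else 0)"
  by (simp add: part_def nth_default_def)

lemma contained_iff: "contained mu nu \<longleftrightarrow> (\<forall>i. part mu (Suc i) \<le> part nu (Suc i))"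
proof -
  have "part mu i \<le> part nu i" if "\<forall>i. part mu (Suc i) \<le> part nu (Suc i)" "i \<ge> 1" for i
    using that by (cases i) auto
  then show ?thesis by (auto simp: contained_def)
qed

lemma sum_part:
  assumes "length lam \<le> N"
  shows "(\<Sum>i<N. part lam (Suc i)) = sum_list lam"
proof -
  have "(\<Sum>i<N. part lam (Suc i)) = (\<Sum>i<length lam. part lam (Suc i))"
    using assms by (intro sum.mono_neutral_right) (auto simp: part_Suc)
  then show ?thesis
    by (simp add: part_Suc sum_list_sum_nth atLeast0LessThan)
qed

lemma contained_same_size:
  assumes "contained mu nu" "sum_list mu = sum_list nu" "0 \<notin> set mu" "0 \<notin> set nu"
  shows "mu = nu"
proof -
  define N where "N = max (length mu) (length nu)"
  have le: "part mu (Suc i) \<le> part nu (Suc i)" for i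
    using assms(1) by (simp add: contained_iff)
  have sums: "(\<Sum>i<N. part mu (Suc i)) = (\<Sum>i<N. part nu (Suc i))"
    using assms(2) by (simp add: sum_part N_def)
  have eq: "part mu (Suc i) = part nu (Suc i)" if "i < N" for i
    using sum_mono_inv[OF sums] le that by auto
  have len: "length mu = length nu"
  proof (rule ccontr)
    assume "length mu \<noteq> length nu"
    then consider "length mu < length nu" | "length nu < length mu" by linarith
    then show False
    proof cases
      case 1
      then show False using eq[of "length mu"] assms(4) nth_mem[of "length mu" nu]
        by (simp add: part_Suc N_def)
    next
      case 2
      then show False using eq[of "length nu"] assms(3) nth_mem[of "length nu" mu]
        by (simp add: part_Suc N_def)
    qed
  qed
  show ?thesis
    using len eq by (intro nth_equalityI) (auto simp: part_Suc N_def split: if_splits)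
qed

lemma length_word: "length (word T) = sum_list (shape T)"
  by (simp add: word_def shape_def length_concat sum_list_rev flip: rev_map)

lemma word_append: "word (S @ T) = word T @ word S"
  by (simp add: word_def)

lemma cut_concat: "cut (map length xs) (concat xs) = xs"
  by (induction xs) auto

lemma refill_word: "refill (shape T) (word T) = T"
  by (simp add: refill_def shape_def word_def rev_map cut_concat)

lemma map_length_cut: "sum_list mu \<le> length w \<Longrightarrow> map length (cut mu w) = mu"
  by (induction mu arbitrary: w) auto

lemma shape_refill: "sum_list mu \<le> length w \<Longrightarrow> shape (refill mu w) = mu"
  by (simp add: shape_def refill_def map_length_cut sum_list_rev flip: rev_map)

lemma length_sigma_word: "length (sigma_word i w) = length w"
proof -
  have "length (fold (\<lambda>(p, y) v. v[p := y]) xs w) = length w"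
    for xs :: "(nat \<times> nat) list" and w :: "nat list"
    by (induction xs arbitrary: w) auto
  then show ?thesis by (simp add: sigma_word_def Let_def)
qed

lemma shape_sigma: "shape (sigma i T) = shape T"
  by (simp add: sigma_def shape_refill length_sigma_word length_word)

lemma shape_foldr_sigma: "shape (foldr sigma js T) = shape T"
  by (induction js) (auto simp: shape_sigma)

section \<open>The symmetric group action on completely paired words\<close>

lemma unpaired_push:
  assumes "\<forall>x \<in> set xs. snd x = i + 1"
  shows "unpaired i st (xs @ ys) = unpaired i (rev xs @ st) ys"
  using assms by (induction xs arbitrary: st) auto

lemma unpaired_pop:
  assumes "\<forall>x \<in> set xs. snd x = i" "\<forall>x \<in> set st. snd x = i + 1" "length xs = length st"
  shows "unpaired i st (xs @ ys) = unpaired i [] ys"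
  using assms
proof (induction xs arbitrary: st)
  case (Cons x xs)
  then show ?case by (cases st; cases x) auto
qed simp

lemma unpaired_paired:
  assumes "\<forall>x \<in> set A. snd x = i + 1" "\<forall>x \<in> set B. snd x = i" "length A = length B"
    "\<forall>x \<in> set C. snd x = i + 1"
  shows "unpaired i [] (A @ B @ C) = C"
proof -
  have "unpaired i [] (A @ B @ C) = unpaired i [] C"
    using assms by (simp add: unpaired_push unpaired_pop)
  also have "\<dots> = C"
    using unpaired_push[OF assms(4), of "[]" "[]"] by simp
  finally show ?thesis .
qed

text \<open>The prefix \<open>V\<close> makes the induction on \<open>Z\<close> work: positions are counted from \<open>length V\<close> on.\<close>

lemma fold_update_filter_enumerate:
  "fold (\<lambda>(p, y) v. v[p := y])
     (zip (map fst (filter (\<lambda>(p, x). P x) (List.enumerate (length V) Z)))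
       (replicate (length (filter (\<lambda>(p, x). P x) (List.enumerate (length V) Z))) i)) (V @ Z)
   = V @ map (\<lambda>x. if P x then i else x) Z"
proof (induction Z arbitrary: V)
  case (Cons z Z)
  show ?case
    using Cons.IH[of "V @ [i]"] Cons.IH[of "V @ [z]"] by simp
qed simp

text \<open>
  All letters \<open>i\<close> are paired with the block \<open>(i+1)\<^sup>p\<close>, so the unpaired letters are exactly the
  letters \<open>i + 1\<close> of \<open>Z\<close>, and each of them is lowered.
\<close>

lemma sigma_word_paired:
  assumes "i \<notin> set X" "i + 1 \<notin> set X" "i \<notin> set Z"
  shows "sigma_word i (X @ replicate p (i + 1) @ replicate p i @ Z) =
    X @ replicate p (i + 1) @ replicate p i @ map (\<lambda>x. if x = i + 1 then i else x) Z"
proof -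
  define w where "w = X @ replicate p (i + 1) @ replicate p i @ Z"
  define V where "V = X @ replicate p (i + 1) @ replicate p i"
  define Q where "Q = (\<lambda>(q::nat, x). x = i \<or> x = i + 1)"
  have w: "w = V @ Z" by (simp add: w_def V_def)
  define A where "A = List.enumerate (length X) (replicate p (i + 1))"
  define B where "B = List.enumerate (length X + p) (replicate p i)"
  define C where "C = filter (\<lambda>(q, x). x = i + 1) (List.enumerate (length V) Z)"
  have none: "filter Q (List.enumerate 0 X) = []"
    using assms(1,2)
    by (auto simp: filter_empty_conv Q_def enumerate_eq_zip dest: set_zip_rightD)
  have A: "filter Q A = A" "\<forall>x \<in> set A. snd x = i + 1" "length A = p"
    by (auto simp: A_def Q_def in_set_enumerate_eq intro!: filter_True)
  have B: "filter Q B = B" "\<forall>x \<in> set B. snd x = i" "length B = p"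
    by (auto simp: B_def Q_def in_set_enumerate_eq intro!: filter_True)
  have "snd x \<noteq> i" if "x \<in> set (List.enumerate (length V) Z)" for x
  proof -
    have "snd x \<in> set Z"
      using that set_zip_rightD[of "fst x" "snd x"] unfolding enumerate_eq_zip by simp
    then show ?thesis using assms(3) by auto
  qed
  then have C: "filter Q (List.enumerate (length V) Z) = C" "\<forall>x \<in> set C. snd x = i + 1"
    by (fastforce simp: C_def Q_def intro!: filter_cong, auto simp: C_def)
  have "zip [0..<length w] w = List.enumerate 0 w"
    by (simp add: enumerate_eq_zip)
  also have "\<dots> = List.enumerate 0 X @ A @ B @ List.enumerate (length V) Z"
    by (simp add: w_def A_def B_def V_def enumerate_append_eq add.assoc)
  finally have letters: "filter Q (zip [0..<length w] w) = A @ B @ C"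
    using none A(1) B(1) C(1) by simp
  have us: "unpaired i [] (filter Q (zip [0..<length w] w)) = C"
    unfolding letters using A B C by (intro unpaired_paired) auto
  have r: "filter (\<lambda>(q, x). x = i) C = []"
    using C(2) by (auto simp: filter_empty_conv)
  have s: "filter (\<lambda>(q, x). x = i + 1) C = C"
    using C(2) by (auto intro!: filter_True)
  have "sigma_word i w =
      fold (\<lambda>(q, y) v. v[q := y]) (zip (map fst C) (replicate (length C) i)) w"
    unfolding sigma_word_def Let_def Q_def[symmetric] us r s by simp
  also have "\<dots> = V @ map (\<lambda>x. if x = i + 1 then i else x) Z"
    unfolding w C_def by (rule fold_update_filter_enumerate)
  finally show ?thesis by (simp add: w_def V_def)
qed

section \<open>Superstandard tableaux and the promotion chain\<close>

definition superstandard :: "nat list \<Rightarrow> filling" where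
  "superstandard lam = map (\<lambda>i. replicate (lam ! i) (Suc i)) [0..<length lam]"

text \<open>
  The tableaux met while \<open>\<sigma>\<^sub>m, \<dots>, \<sigma>\<^sub>1\<close> act: the strip letter is \<open>j\<close>, and every row below row \<open>j\<close>
  ends with the cells of the strip \<open>(\<lambda>\<^sub>1, \<lambda>\<^sub>2, \<dots>)/(\<lambda>\<^sub>2, \<lambda>\<^sub>3, \<dots>)\<close>.  The cells of the strip in the
  rows from \<open>j\<close> on carry the letter of their row.
\<close>

definition lowered_row :: "nat list \<Rightarrow> nat \<Rightarrow> nat \<Rightarrow> nat list" where
  "lowered_row lam j i =
     (if Suc i < j then replicate (lam ! Suc i) (Suc i) @ replicate (lam ! i - lam ! Suc i) j
      else replicate (lam ! i) (Suc i))"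

definition lowered :: "nat list \<Rightarrow> nat \<Rightarrow> filling" where
  "lowered lam j = map (lowered_row lam j) [0..<length lam]"

lemma lowered_1: "lowered lam 1 = superstandard lam"
  by (simp add: lowered_def superstandard_def lowered_row_def)

lemma shape_lowered:
  assumes "is_partition lam" "j \<le> length lam"
  shows "shape (lowered lam j) = lam"
proof (rule nth_equalityI)
  fix i assume "i < length (shape (lowered lam j))"
  then have "i < length lam" by (simp add: shape_def lowered_def)
  then show "shape (lowered lam j) ! i = lam ! i"
    using assms is_partition_nth_mono[of lam i "Suc i"]
    by (simp add: shape_def lowered_def lowered_row_def)
qed (simp add: shape_def lowered_def)

lemma shape_superstandard: "shape (superstandard lam) = lam"
  by (intro nth_equalityI) (auto simp: shape_def superstandard_def)

lemma is_tableau_lowered: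
  assumes part: "is_partition lam" and j: "1 \<le> j" "j \<le> length lam"
  shows "is_tableau (lowered lam j)"
  unfolding is_tableau_def
proof (intro conjI allI impI)
  show "is_partition (shape (lowered lam j))"
    using part j by (simp add: shape_lowered)
  show "0 \<notin> set (word (lowered lam j))"
    using j by (auto simp: word_def lowered_def lowered_row_def)
  show "\<forall>R \<in> set (lowered lam j). sorted R"
    by (auto simp: lowered_def lowered_row_def sorted_append)
next
  fix i c assume *: "Suc i < length (lowered lam j) \<and> c < length (lowered lam j ! Suc i)"
  then have i: "Suc i < length lam" by (simp add: lowered_def)
  have "length (lowered lam j ! Suc i) = lam ! Suc i"
    using shape_lowered[OF part j(2)] i by (metis length_map nth_map shape_def)
  with * have c: "c < lam ! Suc i" by simp
  have le: "lam ! Suc i \<le> lam ! i"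
    using part i by (intro is_partition_nth_mono) auto
  have "lowered_row lam j i ! c = Suc i"
    using c le by (simp add: lowered_row_def nth_append)
  moreover have "lowered_row lam j (Suc i) ! c \<ge> Suc (Suc i)"
  proof (cases "Suc (Suc i) < j")
    case True
    then have "lam ! Suc (Suc i) \<le> lam ! Suc i"
      using part j by (intro is_partition_nth_mono) auto
    then show ?thesis
      using True c by (auto simp: lowered_row_def nth_append)
  next
    case False
    then show ?thesis using c by (simp add: lowered_row_def)
  qed
  ultimately show "lowered lam j ! i ! c < lowered lam j ! Suc i ! c"
    using i by (simp add: lowered_def)
qed

text \<open>
  In the letters \<open>j, j + 1\<close> the reading word is \<open>(j+1)\<^sup>p j\<^sup>p (j+1)\<^sup>q\<close> with \<open>p = \<lambda>\<^sub>j\<^sub>+\<^sub>1\<close>: row \<open>j + 1\<close>,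
  then row \<open>j\<close>, whose letters \<open>j\<close> are those outside the strip, then the strip cells in the rows up to
  \<open>j\<close>.
\<close>

lemma sigma_lowered:
  assumes part: "is_partition lam" and j: "1 \<le> j" "j < length lam"
  shows "sigma j (lowered lam (Suc j)) = lowered lam j"
proof -
  obtain h where h: "j = Suc h" using j by (cases j) auto
  define p where "p = lam ! Suc h"
  define q where "q = lam ! h - lam ! Suc h"
  let ?f = "\<lambda>x. if x = j + 1 then j else x"
  define low where "low = map (lowered_row lam (Suc j)) [0..<h]"
  define up where "up = map (lowered_row lam j) [Suc (Suc h)..<length lam]"
  define Z where "Z = replicate q (j + 1) @ word low"
  have upt: "[0..<length lam] = [0..<h] @ [h, Suc h] @ [Suc (Suc h)..<length lam]"
  proof -
    have "[0..<length lam] = [0..<h] @ [h..<length lam]"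
      using j h upt_add_eq_append[of 0 h "length lam - h"] by simp
    then show ?thesis using j h by (simp add: upt_conv_Cons)
  qed
  have le: "lam ! Suc h \<le> lam ! h"
    using part j h by (intro is_partition_nth_mono) auto
  have up': "map (lowered_row lam (Suc j)) [Suc (Suc h)..<length lam] = up"
    using h by (simp add: up_def lowered_row_def)
  have low': "map (lowered_row lam j) [0..<h] = map (map ?f) low"
    using h by (simp add: low_def lowered_row_def)
  have row: "lowered_row lam j h = replicate p j @ replicate q j"
    using le h by (simp add: lowered_row_def p_def q_def replicate_add[symmetric])
  have "lowered lam (Suc j) = low @ [replicate p j @ replicate q (j + 1), replicate p (j + 1)] @ up"
    using up' h by (simp add: lowered_def upt low_def lowered_row_def p_def q_def)
  then have word1:
    "word (lowered lam (Suc j)) = word up @ replicate p (j + 1) @ replicate p j @ Z"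
    by (simp add: word_def Z_def)
  have "lowered lam j = map (map ?f) low @ [replicate p j @ replicate q j, replicate p (j + 1)] @ up"
    using low' row h by (simp add: lowered_def upt lowered_row_def p_def up_def)
  then have word2:
    "word (lowered lam j) = word up @ replicate p (j + 1) @ replicate p j @ map ?f Z"
    by (simp add: word_def Z_def map_concat rev_map)
  have "j \<notin> set (word up)" "j + 1 \<notin> set (word up)"
    using h by (auto simp: word_def up_def lowered_row_def)
  moreover have "j \<notin> set Z"
    using h by (auto simp: word_def Z_def low_def lowered_row_def split: if_splits)
  ultimately have "sigma_word j (word (lowered lam (Suc j))) = word (lowered lam j)"
    unfolding word1 word2 by (rule sigma_word_paired)
  then have "sigma j (lowered lam (Suc j)) = refill (shape (lowered lam j)) (word (lowered lam j))"
    using part j by (simp add: sigma_def shape_lowered)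
  then show ?thesis by (simp add: refill_word)
qed

lemma foldr_sigma_lowered:
  assumes "is_partition lam" "n < length lam"
  shows "foldr sigma [1..<Suc n] (lowered lam (Suc n)) = superstandard lam"
  using assms(2)
proof (induction n)
  case 0
  then show ?case using lowered_1[of lam] by simp
next
  case (Suc n)
  then show ?case using sigma_lowered[OF assms(1), of "Suc n"] by simp
qed

lemma superstandard_snoc:
  "superstandard (lam @ [x]) = superstandard lam @ [replicate x (Suc (length lam))]"
  by (simp add: superstandard_def nth_append)

lemma set_word_superstandard:
  assumes "0 \<notin> set lam"
  shows "set (word (superstandard lam)) = {1..length lam}"
proof -
  have "lam ! i \<noteq> 0" if "i < length lam" for i
    using assms that by (metis nth_mem)
  then have "x \<in> set (word (superstandard lam)) \<longleftrightarrow> (\<exists>i<length lam. x = Suc i)" for x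
    by (auto simp: word_def superstandard_def)
  moreover have "(\<exists>i<length lam. x = Suc i) \<longleftrightarrow> x \<in> {1..length lam}" for x
    by (cases x) auto
  ultimately show ?thesis by blast
qed

lemma max_letter_superstandard:
  assumes "0 \<notin> set lam"
  shows "max_letter (word (superstandard lam)) = length lam"
  unfolding max_letter_def set_word_superstandard[OF assms]
  by (cases lam) (auto intro!: Max_eqI)

lemma count_word_superstandard:
  "count_list (word (superstandard lam)) (Suc i) = part lam (Suc i)"
proof (induction lam rule: rev_induct)
  case Nil
  then show ?case by (simp add: superstandard_def word_def part_Suc)
next
  case (snoc x lam)
  have "count_list (replicate x a) b = (if a = b then x else 0)" for a b :: nat
    by (induction x) auto
  then show ?case using snoc
    by (auto simp: superstandard_snoc word_append part_Suc nth_append word_def)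
qed

lemma nonincreasing_word_superstandard:
  "sorted_wrt (\<ge>) (word (superstandard lam))"
proof (induction lam rule: rev_induct)
  case Nil
  then show ?case by (simp add: superstandard_def word_def)
next
  case (snoc x lam)
  have "sorted_wrt (\<ge>) (replicate x (a::nat))" for a
    by (induction x) auto
  moreover have "b \<le> Suc (length lam)" if "b \<in> set (word (superstandard lam))" for b
    using that by (auto simp: word_def superstandard_def split: if_splits)
  ultimately show ?case using snoc
    by (auto simp: superstandard_snoc word_append sorted_wrt_append word_def)
qed

section \<open>Adding a horizontal strip\<close>

text \<open>A finite sum is needed because a sum over an infinite set of tableaux would be \<open>0\<close>.\<close>

lemma finite_strip_additions: "finite (strip_additions r x T)"
proof -
  define A where "A = insert x (set (word T))"
  define N where "N = sum_list (shape T) + r"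
  define M where "M = length T + 1"
  have "strip_additions r x T \<subseteq>
      {T'. set T' \<subseteq> {R. set R \<subseteq> A \<and> length R \<le> N} \<and> length T' \<le> M}"
  proof
    fix T' assume "T' \<in> strip_additions r x T"
    then have tab: "is_tableau T'" and hs: "horizontal_strip r (shape T') (shape T)"
      and rows: "\<forall>i < length T'. \<exists>n. T' ! i = nth_default [] T i @ replicate n x"
      by (auto simp: strip_additions_def)
    have "length T' \<le> M"
    proof (rule ccontr)
      assume "\<not> length T' \<le> M"
      then have long: "M < length T'" by simp
      have "part (shape T') (M + 1) \<le> part (shape T) M"
        using hs by (auto simp: horizontal_strip_def M_def)
      also have "\<dots> = 0" by (simp add: M_def part_Suc shape_def)
      finally have "shape T' ! M = 0" using long by (simp add: part_Suc shape_def)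
      then have "0 \<in> set (shape T')" using long by (metis length_map nth_mem shape_def)
      then show False using tab by (simp add: is_tableau_def is_partition_def)
    qed
    moreover have "set R \<subseteq> A \<and> length R \<le> N" if R: "R \<in> set T'" for R
    proof
      obtain i where i: "i < length T'" "R = T' ! i"
        using R by (auto simp: in_set_conv_nth)
      obtain n where n: "R = nth_default [] T i @ replicate n x" using rows i by auto
      have "set (nth_default [] T i) \<subseteq> set (word T)"
        by (auto simp: nth_default_def word_def intro: nth_mem)
      then show "set R \<subseteq> A" using n by (auto simp: A_def split: if_splits)
      have "length R \<le> sum_list (shape T')"
        using R by (auto simp: shape_def intro!: member_le_sum_list)
      then show "length R \<le> N" using hs by (simp add: horizontal_strip_def N_def)
    qed
    ultimately show "T' \<in> {T'. set T' \<subseteq> {R. set R \<subseteq> A \<and> length R \<le> N} \<and> length T' \<le> M}"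
      by auto
  qed
  moreover have "finite {R. set R \<subseteq> A \<and> length R \<le> N}"
    by (rule finite_lists_length_le) (simp add: A_def)
  then have "finite {T'. set T' \<subseteq> {R. set R \<subseteq> A \<and> length R \<le> N} \<and> length T' \<le> M}"
    by (rule finite_lists_length_le)
  ultimately show ?thesis by (rule finite_subset)
qed

lemma lowered_in_strip_additions:
  assumes part: "is_partition (a # mu)"
  shows "lowered (a # mu) (Suc (length mu)) \<in>
    strip_additions a (Suc (length mu)) (superstandard mu)"
proof -
  let ?T = "lowered (a # mu) (Suc (length mu))"
  have shape: "shape ?T = a # mu" using part by (intro shape_lowered) auto
  have "part mu (Suc i) \<le> part (a # mu) (Suc i)" for i
    using is_partition_nth_mono[OF part, of i "Suc i"] by (auto simp: part_Suc)
  then have "contained mu (a # mu)" by (simp add: contained_iff)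
  moreover have "part (a # mu) (i + 1) \<le> part mu i" if "i \<ge> 1" for i
    using that by (cases i) (auto simp: part_Suc)
  ultimately have "horizontal_strip a (a # mu) mu" by (simp add: horizontal_strip_def)
  moreover have "is_tableau ?T" using part by (intro is_tableau_lowered) auto
  moreover have "\<exists>n. ?T ! i = nth_default [] (superstandard mu) i @ replicate n (Suc (length mu))"
    if "i < length ?T" for i
  proof -
    have i: "i < Suc (length mu)" using that by (simp add: lowered_def)
    then have T: "?T ! i = lowered_row (a # mu) (Suc (length mu)) i"
      unfolding lowered_def by (subst nth_map) (auto simp del: upt_Suc)
    show ?thesis
    proof (cases "i < length mu")
      case True
      then show ?thesis unfolding T
        by (auto simp: lowered_row_def nth_default_def superstandard_def)
    next
      case False
      then have "i = length mu" using i by simp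
      then show ?thesis unfolding T
        by (auto simp: lowered_row_def nth_default_def superstandard_def)
    qed
  qed
  ultimately show ?thesis by (simp add: strip_additions_def shape shape_superstandard)
qed

text \<open>Every row of the extension is prescribed up to the number of added letters.\<close>

lemma strip_additions_determined:
  assumes "T1 \<in> strip_additions r x T" "T2 \<in> strip_additions r x T" "shape T1 = shape T2"
  shows "T1 = T2"
proof (rule nth_equalityI)
  show len: "length T1 = length T2" using assms(3) by (metis length_map shape_def)
  fix i assume i: "i < length T1"
  obtain m where m: "T1 ! i = nth_default [] T i @ replicate m x"
    using assms(1) i by (auto simp: strip_additions_def)
  obtain n where n: "T2 ! i = nth_default [] T i @ replicate n x"
    using assms(2) i len by (auto simp: strip_additions_def)
  have "length (T1 ! i) = length (T2 ! i)" using assms(3) i len by (metis nth_map shape_def)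
  then show "T1 ! i = T2 ! i" using m n by simp
qed

lemma strip_additions_shape_iff:
  assumes "is_partition (a # mu)"
    and "T \<in> strip_additions a (Suc (length mu)) (superstandard mu)"
  shows "shape T = a # mu \<longleftrightarrow> T = lowered (a # mu) (Suc (length mu))"
  using strip_additions_determined[OF assms(2) lowered_in_strip_additions[OF assms(1)]]
    shape_lowered[OF assms(1), of "Suc (length mu)"] by auto

section \<open>Filtering by a single block\<close>

lemma k_split_single:
  assumes part: "is_partition lam" and ne: "lam \<noteq> []" and hook: "main_hook lam \<le> int k"
  shows "k_split k lam = [lam]"
  unfolding k_split_def
proof (rule the_equality)
  show "is_k_split k lam [lam]" using assms by (simp add: is_k_split_def)
next
  fix S assume S: "is_k_split k lam S"
  then obtain mu S' where S': "S = mu # S'" using ne by (cases S) (auto simp: is_k_split_def)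
  have "S' = []"
  proof (rule ccontr)
    assume "S' \<noteq> []"
    then obtain nu S'' where S'': "S' = nu # S''" by (cases S') auto
    have lam: "lam = mu @ nu @ concat S''" and ne': "mu \<noteq> []" "nu \<noteq> []"
      and full: "main_hook mu = int k"
      using S by (auto simp: is_k_split_def S' S'')
    have "part lam 1 = part mu 1" using lam ne' by (simp add: part_Suc nth_append)
    moreover have "length mu < length lam" using lam ne' by simp
    ultimately show False using hook full by (simp add: main_hook_def)
  qed
  then show "S = [lam]" using S S' by (simp add: is_k_split_def)
qed

text \<open>Knuth equivalence preserves the length of words.\<close>

lemma tableau_of_word_Nil: "tableau_of_word [] = []"
  unfolding tableau_of_word_def
proof (rule the_equality)
  show "is_tableau [] \<and> knuth_equiv (word []) []"
    by (simp add: is_tableau_def is_partition_def shape_def word_def knuth_equiv_def)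
next
  fix T assume T: "is_tableau T \<and> knuth_equiv (word T) []"
  have step: "length u = length v" if "knuth_step u v" for u v
    using that by cases auto
  have "length u = length v" if "equivclp knuth_step u v" for u v
    using that by (induction rule: equivclp_induct) (auto dest: step)
  then have "word T = []" using T by (fastforce simp: knuth_equiv_def)
  moreover have "[] \<notin> set T"
    using T by (auto simp: is_tableau_def is_partition_def shape_def)
  ultimately show "T = []" by (cases T) (auto simp: word_def)
qed

lemma P_op_superstandard:
  assumes part: "is_partition lam" and ne: "lam \<noteq> []"
  shows "P_op [lam] (frag_of (superstandard lam)) = frag_of (superstandard lam)"
proof -
  let ?T = "superstandard lam"
  have shape: "shape ?T = lam" by (rule shape_superstandard)
  have len: "length ?T = length lam" by (simp add: superstandard_def)
  have row: "length (?T ! i) = lam ! i" if "i < length lam" for i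
    using that by (simp add: superstandard_def)
  have sub: "subtableau lam ?T = ?T"
    by (rule nth_equalityI) (auto simp: subtableau_def len row)
  have tab: "is_tableau ?T"
    using is_tableau_lowered[of lam 1] part ne lowered_1 by (simp add: Suc_leI)
  have "count_list (word ?T) i = (if i \<le> 0 then 0 else part lam (i - 0))" if "i \<ge> 1" for i
    using that by (cases i) (simp_all add: count_word_superstandard)
  then have "\<exists>m. \<forall>i \<ge> 1. count_list (word ?T) i = (if i \<le> m then 0 else part lam (i - m))"
    by blast
  then have S: "?T \<in> S_set lam" by (simp add: S_set_def tab shape)
  have "word_right lam ?T = []"
    unfolding word_right_def word_def
    by (auto simp: in_set_conv_nth len row)
  moreover have "word_above lam ?T = []" by (simp add: word_above_def len word_def)
  moreover have "contained lam lam" by (simp add: contained_def)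
  ultimately have "katabolism lam (frag_of ?T) = frag_of []"
    using S shape sub by (simp add: katabolism_def tableau_of_word_Nil)
  then show ?thesis by (simp add: P_op_def)
qed

lemma P_op_other_shape:
  assumes "is_partition lam" "is_partition (shape T)" "sum_list (shape T) = sum_list lam"
    "shape T \<noteq> lam"
  shows "P_op [lam] (frag_of T) = 0"
proof -
  have "\<not> contained lam (shape T)"
    using assms contained_same_size[of lam "shape T"] by (auto simp: is_partition_def)
  then have "katabolism lam (frag_of T) = 0" by (simp add: katabolism_def)
  then show ?thesis by (simp add: P_op_def)
qed

section \<open>The super atom\<close>

lemma super_atom_step:
  assumes part: "is_partition (a # mu)"
  shows "P_op [a # mu] (promotion a (frag_of (superstandard mu))) =
    frag_of (superstandard (a # mu))"
proof -
  let ?m = "length mu"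
  let ?F = "foldr sigma [1..<Suc ?m]"
  define A where "A = strip_additions a (Suc ?m) (superstandard mu)"
  define T0 where "T0 = lowered (a # mu) (Suc ?m)"
  have fin: "finite A" by (simp add: A_def finite_strip_additions)
  have max: "max_letter (word (superstandard mu)) = ?m"
    using part by (intro max_letter_superstandard) (auto simp: is_partition_def)
  have "P_op [a # mu] (promotion a (frag_of (superstandard mu))) =
      (\<Sum>T\<in>A. P_op [a # mu] (frag_of (?F T)))"
    using fin
    by (simp add: promotion_def P_op_def R_op_def sum_of_set_def max A_def[symmetric]
        frag_extend_sum o_def del: upt_Suc)
  also have "\<dots> = (\<Sum>T\<in>A. if T = T0 then frag_of (superstandard (a # mu)) else 0)"
  proof (rule sum.cong[OF refl])
    fix T assume T: "T \<in> A"
    show "P_op [a # mu] (frag_of (?F T)) =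
        (if T = T0 then frag_of (superstandard (a # mu)) else 0)"
    proof (cases "T = T0")
      case True
      have "?F T = superstandard (a # mu)"
        unfolding True T0_def using part by (intro foldr_sigma_lowered) auto
      then show ?thesis using True P_op_superstandard[OF part] by (simp del: upt_Suc)
    next
      case False
      then have "shape T \<noteq> a # mu"
        using strip_additions_shape_iff[OF part] T by (simp add: A_def T0_def)
      moreover have "is_partition (shape T)" "sum_list (shape T) = sum_list (a # mu)"
        using T by (auto simp: A_def strip_additions_def is_tableau_def horizontal_strip_def
            shape_superstandard)
      ultimately have "P_op [a # mu] (frag_of (?F T)) = 0"
        by (intro P_op_other_shape[OF part]) (simp_all only: shape_foldr_sigma not_False_eq_True)
      then show ?thesis using False by simp
    qed
  qed
  also have "\<dots> = frag_of (superstandard (a # mu))"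
    using fin lowered_in_strip_additions[OF part] by (simp add: A_def T0_def)
  finally show ?thesis .
qed

lemma super_atom_small_hook:
  assumes "is_partition lam" "main_hook lam \<le> int k"
  shows "super_atom k lam = frag_of (superstandard lam)"
  using assms
proof (induction lam)
  case Nil
  then show ?case by (simp add: superstandard_def)
next
  case (Cons a mu)
  have part: "is_partition mu" using Cons.prems(1) by (rule is_partition_Cons)
  have "part mu 1 \<le> part (a # mu) 1"
    using is_partition_nth_mono[OF Cons.prems(1), of 0 1] by (simp add: part_Suc)
  then have "main_hook mu \<le> int k" using Cons.prems(2) by (simp add: main_hook_def)
  then have "super_atom k mu = frag_of (superstandard mu)" using Cons.IH part by simp
  then show ?case
    using Cons.prems by (simp add: k_split_single super_atom_step)
qed

section \<open>The charge of a nonincreasing word\<close>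

text \<open>
  The premise on \<open>p\<close> keeps every letter still to be met in the round to the left of the current
  position, so the label is never increased.  It is preserved because, in a nonincreasing word, all
  letters greater than \<open>j\<close> lie to the left of every \<open>j\<close>.
\<close>

lemma fold_charge_step:
  assumes dec: "sorted_wrt (\<ge>) w"
  shows "U \<subseteq> {..<length w} \<Longrightarrow> \<forall>q < length w. w ! q \<ge> j \<longrightarrow> q < p \<Longrightarrow>
    \<exists>U' p'. U' \<subseteq> {..<length w} \<and> fold (charge_step w) [j..<j + n] (U, p, 0, 0) = (U', p', 0, 0)"
proof (induction n arbitrary: j U p)
  case 0
  then show ?case by simp
next
  case (Suc n)
  define C where "C = {q \<in> U. w ! q = j}"
  have list: "[j..<j + Suc n] = j # [Suc j..<Suc j + n]"
    by (simp add: upt_conv_Cons del: upt_Suc)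
  show ?case
  proof (cases "C = {}")
    case True
    then have "charge_step w j (U, p, 0, 0) = (U, p, 0, 0)"
      by (simp add: charge_step_def C_def)
    then show ?thesis using Suc.IH[of U "Suc j" p] Suc.prems
      unfolding list by (simp del: upt_Suc)
  next
    case False
    have fin: "finite C" unfolding C_def using Suc.prems(1) finite_subset[of U] by auto
    have below: "\<forall>q \<in> C. q < p" using Suc.prems by (auto simp: C_def)
    define q where "q = Max C"
    have qC: "q \<in> C" unfolding q_def using fin False by (rule Max_in)
    have left: "{q \<in> C. q < p} = C" and ex: "\<exists>q \<in> C. q < p" using below qC by auto
    have step: "charge_step w j (U, p, 0, 0) = (U - {q}, q, 0, 0)"
      unfolding charge_step_def prod.case C_def[symmetric] Let_def left q_def
      using False ex by (simp only: if_True if_False) simp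
    have "q' < q" if q': "q' < length w" "w ! q' \<ge> Suc j" for q'
    proof (rule ccontr)
      assume "\<not> q' < q"
      moreover have "w ! q = j" using qC by (simp add: C_def)
      moreover have "q' \<noteq> q" using q' \<open>w ! q = j\<close> by auto
      ultimately have "q < q'" by simp
      then have "w ! q' \<le> w ! q"
        using sorted_wrt_nth_less[OF dec _ q'(1)] by simp
      then show False using q' \<open>w ! q = j\<close> by simp
    qed
    then show ?thesis
      using Suc.IH[of "U - {q}" "Suc j" q] Suc.prems(1) step
      unfolding list by (auto simp del: upt_Suc)
  qed
qed

lemma charge_partition_nonincreasing:
  assumes "sorted_wrt (\<ge>) w"
  shows "charge_partition w = 0"
proof -
  have round: "\<exists>U'. U' \<subseteq> {..<length w} \<and> charge_round w (U, 0) = (U', 0)"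
    if U: "U \<subseteq> {..<length w}" for U
    using fold_charge_step[OF assms U, of 1 "length w" "max_letter w"]
    by (auto simp: charge_round_def)
  have "\<exists>U'. U' \<subseteq> {..<length w} \<and> (charge_round w ^^ n) ({..<length w}, 0) = (U', 0)" for n
  proof (induction n)
    case (Suc n)
    then obtain U where "U \<subseteq> {..<length w}" "(charge_round w ^^ n) ({..<length w}, 0) = (U, 0)"
      by blast
    then show ?case using round[of U] by simp
  qed simp
  then show ?thesis unfolding charge_partition_def by (metis snd_conv)
qed

lemma charge_superstandard:
  assumes "is_partition lam"
  shows "charge (word (superstandard lam)) = 0"
proof -
  have "part lam (Suc (Suc i)) \<le> part lam (Suc i)" for i
    using is_partition_nth_mono[OF assms, of i "Suc i"] by (simp add: part_Suc)
  then have "count_list (word (superstandard lam)) (i + 1) \<le> count_list (word (superstandard lam)) i"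
    if "i \<ge> 1" for i
    using that by (cases i) (simp_all add: count_word_superstandard)
  then have "partition_evaluation (word (superstandard lam))"
    by (simp add: partition_evaluation_def)
  then show ?thesis
    by (simp add: charge_def charge_partition_nonincreasing nonincreasing_word_superstandard)
qed

section \<open>Atoms of small main hook-length\<close>

theorem mainTheorem1:
  fixes k :: nat and lam :: "nat list"
  assumes "k \<ge> 1"
    and "is_partition lam"
    and "k_bounded k lam"
    and "int k \<ge> main_hook lam"
  shows "atom_fn k lam = schur lam"
proof
  fix \<alpha>
  have "super_atom k lam = frag_of (superstandard lam)"
    using assms by (intro super_atom_small_hook) auto
  then show "atom_fn k lam \<alpha> = schur lam \<alpha>"
    using charge_superstandard[OF assms(2)]
    by (simp add: atom_fn_def digamma_map_def shape_superstandard)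
qed

end
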